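(* Let $q$ be a prime power and $m,n$ positive integers. If $h_{q^m}(n)=k$, then $h_{\tau_3}(\mathbb{F}_q^{mn})\ge mk$. Consequently, if $h_{\tau_3}(\mathbb{F}_q^{mn})\le m-1$, then $h_{q^m}(n)=0$.
   Context: For a prime power $Q$ and $n\in\mathbb{N}$, with $\tau$ the cyclic shift $(u_1,\dots,u_n)\mapsto(u_n,u_1,\dots,u_{n-1})$ on $\mathbb{F}_Q^n$, a subspace $U$ is cyclically covering if $\bigcup_{i=0}^{n-1}\tau^i(U)=\mathbb{F}_Q^n$, and $h_Q(n)$ is the largest codimension of a cyclically covering subspace of $\mathbb{F}_Q^n$. Write vectors of $\mathbb{F}_q^{mn}$ as $(b_1,\dots,b_n)$ with blocks $b_i\in\mathbb{F}_q^m$ and let $\tau_3(b_1,\dots,b_n)=(b_n,b_1,\dots,b_{n-1})$ (the cyclic shift by $m$ coordinates; $\tau_3^n=\mathrm{id}$). A subspace $U\subseteq\mathbb{F}_q^{mn}$ is a $\tau_3$-covering if $\bigcup_{k=0}^{n-1}\tau_3^k(U)=\mathbb{F}_q^{mn}$, and $h_{\tau_3}(\mathbb{F}_q^{mn})$ is the largest codimension of a $\tau_3$-covering subspace. *)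

theory Defs
  imports "HOL-Library.Function_Algebras" "HOL-Library.Cardinality"
    "HOL-Number_Theory.Prime_Powers"
begin

text \<open>
  A vector \<open>(v\<^sub>1, \<dots>, v\<^sub>d)\<close> over the field \<open>'a\<close> is a function on the natural numbers that vanishes
  from index \<open>d\<close> on; its coordinates sit at the 0-based positions \<open>0, \<dots>, d - 1\<close>. All spaces
  thus live in one ambient vector space, whose subspaces and dimensions are those of
  \<^locale>\<open>vector_space\<close>.
\<close>

definition fun_scale :: "'a::field \<Rightarrow> (nat \<Rightarrow> 'a) \<Rightarrow> (nat \<Rightarrow> 'a)" where
  "fun_scale c v = (\<lambda>i. c * v i)"

interpretation fun_vs: vector_space "fun_scale :: 'a::field \<Rightarrow> (nat \<Rightarrow> 'a) \<Rightarrow> (nat \<Rightarrow> 'a)"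
  by unfold_locales (auto simp: fun_scale_def fun_eq_iff algebra_simps)

definition vectors :: "nat \<Rightarrow> (nat \<Rightarrow> 'a::field) set" where
  "vectors d = {v. \<forall>i\<ge>d. v i = 0}"

definition cyclic_shift :: "nat \<Rightarrow> (nat \<Rightarrow> 'a::field) \<Rightarrow> (nat \<Rightarrow> 'a)" where
  "cyclic_shift n v =
     (\<lambda>i. if i < n then (if i = 0 then v (n - 1) else v (i - 1)) else 0)"

text \<open>
  The \<open>n\<close> blocks of length \<open>m\<close> of a vector of length \<open>m * n\<close> occupy the positions
  \<open>{0..<m}, {m..<2 * m}, \<dots>, {m * (n - 1)..<m * n}\<close>.
\<close>

definition block_shift :: "nat \<Rightarrow> nat \<Rightarrow> (nat \<Rightarrow> 'a::field) \<Rightarrow> (nat \<Rightarrow> 'a)" where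
  "block_shift m n v =
     (\<lambda>i. if i < m * n then (if i < m then v (m * (n - 1) + i) else v (i - m)) else 0)"

definition covering ::
  "((nat \<Rightarrow> 'a::field) \<Rightarrow> (nat \<Rightarrow> 'a)) \<Rightarrow> nat \<Rightarrow> nat \<Rightarrow> (nat \<Rightarrow> 'a) set \<Rightarrow> bool" where
  "covering T n d U \<longleftrightarrow>
     fun_vs.subspace U \<and> U \<subseteq> vectors d \<and> (\<Union>i<n. (T ^^ i) ` U) = vectors d"

abbreviation cyclically_covering :: "nat \<Rightarrow> (nat \<Rightarrow> 'a::field) set \<Rightarrow> bool" where
  "cyclically_covering n \<equiv> covering (cyclic_shift n) n n"

abbreviation block_covering :: "nat \<Rightarrow> nat \<Rightarrow> (nat \<Rightarrow> 'a::field) set \<Rightarrow> bool" where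
  "block_covering m n \<equiv> covering (block_shift m n) n (m * n)"

text \<open>
  Largest codimensions. The truncated subtraction is exact, since the dimension of a subspace of
  \<^term>\<open>vectors d\<close> is at most \<open>d\<close>; the sets of codimensions are hence finite, and for \<open>n > 0\<close> they
  contain 0, the codimension of the whole space.
\<close>

definition h_cyclic :: "'a::field itself \<Rightarrow> nat \<Rightarrow> nat" where
  "h_cyclic _ n =
     Max {n - fun_vs.dim U |U :: (nat \<Rightarrow> 'a) set. cyclically_covering n U}"

definition h_block :: "'a::field itself \<Rightarrow> nat \<Rightarrow> nat \<Rightarrow> nat" where
  "h_block _ m n =
     Max {m * n - fun_vs.dim U |U :: (nat \<Rightarrow> 'a) set. block_covering m n U}"

end

theory Submission
  imports "HOL-Algebra.Algebraic_Closure_Type" "HOL-Number_Theory.Residues" Defs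
begin

text \<open>
  The field \<open>'a\<close> with \<open>q\<close> elements embeds into the field \<open>'b\<close> with \<open>q ^ m\<close> elements, which makes \<open>'b\<close> an
  \<open>m\<close>-dimensional vector space over \<open>'a\<close>. Writing each entry of a vector over \<open>'b\<close> in coordinates over
  \<open>'a\<close> is an additive bijection that turns the cyclic shift into the block shift. It maps covering
  subspaces to covering subspaces, and counting elements shows that dimensions are multiplied by \<open>m\<close>.
\<close>

section \<open>Finite fields: a generator of the unit group, and the Frobenius identity\<close>

lemma card_field_gt_1: "CARD('a::{field, finite}) > 1"
proof -
  have "card {0, 1::'a} \<le> CARD('a)" by (rule card_mono) auto
  then show ?thesis by simp
qed

lemma ring_of_type_algebra_simps:
  "carrier (ring_of_type_algebra :: 'a ring) = UNIV"
  "\<zero>\<^bsub>(ring_of_type_algebra :: 'a ring)\<^esub> = (0 :: 'a::field)"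
  "\<one>\<^bsub>(ring_of_type_algebra :: 'a ring)\<^esub> = (1 :: 'a)"
  "x [^]\<^bsub>ring_of_type_algebra\<^esub> (i::nat) = (x::'a) ^ i"
proof -
  show "x [^]\<^bsub>ring_of_type_algebra\<^esub> (i::nat) = (x::'a) ^ i"
    by (induction i) (simp_all add: ring_of_type_algebra_def nat_pow_def mult.commute)
qed (simp_all add: ring_of_type_algebra_def)

lemma finite_field_mult_generator:
  obtains \<alpha> :: "'a::{field, finite}" where "\<And>x. x \<noteq> 0 \<Longrightarrow> \<exists>i. x = \<alpha> ^ i"
proof -
  have "field (ring_of_type_algebra :: 'a ring)" ..
  from field.finite_field_mult_group_has_gen[OF this]
  have "\<exists>\<alpha>::'a. UNIV - {0} = {\<alpha> ^ i | i::nat. i \<in> UNIV}"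
    by (auto simp: ring_of_type_algebra_simps)
  then obtain \<alpha> :: 'a where "UNIV - {0} = {\<alpha> ^ i | i::nat. i \<in> UNIV}" ..
  then show thesis
    by (intro that[of \<alpha>]) blast
qed

text \<open>For nonzero \<open>x\<close> the order of the unit group, \<open>CARD('a) - 1\<close>,
  annihilates \<open>x\<close>, which gives \<open>x ^ CARD('a) = x\<close>; iterating this
  \<open>k\<close> times gives the claim.\<close>

lemma finite_field_power_card:
  fixes x :: "'a::{field, finite}"
  shows "x ^ (CARD('a) ^ k) = x"
proof -
  have *: "x ^ CARD('a) = x" for x :: 'a
  proof (cases "x = 0")
    case False
    let ?G = "Multiplicative_Group.mult_of (ring_of_type_algebra :: 'a ring)"
    interpret G: group ?G
      by (rule field.field_mult_group[OF field_from_type_algebra])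
    have carr: "carrier ?G = UNIV - {0}"
      by (simp add: ring_of_type_algebra_simps)
    have "x [^]\<^bsub>?G\<^esub> Coset.order ?G = \<one>\<^bsub>?G\<^esub>"
      using False by (intro G.pow_order_eq_1) (auto simp only: carr)
    then have "x ^ (CARD('a) - 1) = 1"
      by (simp only: Coset.order_def carr Multiplicative_Group.nat_pow_mult_of
          Multiplicative_Group.one_mult_of ring_of_type_algebra_simps) (simp add: card_Diff_singleton)
    then show ?thesis
      using power_minus_mult[of "CARD('a)" x] by simp
  qed (simp add: power_0_left)
  show ?thesis
    by (induction k) (simp_all add: power_mult *)
qed

section \<open>Embedding a finite field into a larger one\<close>

abbreviation of_int_poly :: "int poly \<Rightarrow> 'a::comm_ring_1 poly" where
  "of_int_poly \<equiv> map_poly of_int"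

lemma of_int_poly_add: "of_int_poly (P + Q) = of_int_poly P + of_int_poly Q"
  by (simp add: poly_eq_iff coeff_map_poly)

lemma of_int_poly_diff: "of_int_poly (P - Q) = of_int_poly P - of_int_poly Q"
  by (simp add: poly_eq_iff coeff_map_poly)

lemma of_int_poly_mult: "of_int_poly (P * Q) = of_int_poly P * of_int_poly Q"
  by (simp add: poly_eq_iff coeff_map_poly coeff_mult)

lemma of_int_poly_smult: "of_int_poly (Polynomial.smult c P) = Polynomial.smult (of_int c) (of_int_poly P)"
  by (simp add: poly_eq_iff coeff_map_poly)

text \<open>An integer coefficient vanishes in a ring iff the characteristic divides it. Integer
  polynomials thus serve as a common source for both fields, replacing polynomials over the prime
  field.\<close>

lemma of_int_poly_eq_0_transfer:
  assumes "CHAR('a::comm_ring_1) = CHAR('b::comm_ring_1)"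
  shows "(of_int_poly P :: 'a poly) = 0 \<longleftrightarrow> (of_int_poly P :: 'b poly) = 0"
  using assms by (simp add: poly_eq_iff coeff_map_poly of_int_eq_0_iff_char_dvd)

text \<open>Every element of \<open>'a\<close> is the value \<open>F(\<alpha>)\<close> of an integer
  polynomial at a generator \<alpha> of the unit group. The embedding sends
  \<open>F(\<alpha>)\<close> to \<open>F(\<beta>)\<close>, where \<beta> is a root in
  \<open>'b\<close> of a polynomial \<open>P\<close> that divides, up to units and modulo the
  characteristic, every \<open>F\<close> with \<open>F(\<alpha>) = 0\<close>.\<close>

lemma finite_field_embedding:
  assumes char: "CHAR('a::{field, finite}) = CHAR('b::{field, finite})"
    and card: "CARD('b::{field, finite}) = CARD('a::{field, finite}) ^ m"
  obtains \<iota> :: "'a::{field, finite} \<Rightarrow> 'b::{field, finite}"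
  where "\<iota> 1 = 1" "\<And>x y. \<iota> (x + y) = \<iota> x + \<iota> y" "\<And>x y. \<iota> (x * y) = \<iota> x * \<iota> y"
proof -
  obtain \<alpha> :: 'a where gen: "\<And>x. x \<noteq> 0 \<Longrightarrow> \<exists>i. x = \<alpha> ^ i"
    using finite_field_mult_generator by blast
  define eva :: "int poly \<Rightarrow> 'a" where "eva P = poly (of_int_poly P) \<alpha>" for P
  define evb :: "'b \<Rightarrow> int poly \<Rightarrow> 'b" where "evb x P = poly (of_int_poly P) x" for x P
  have eva_simps: "eva (P + Q) = eva P + eva Q" "eva (P - Q) = eva P - eva Q"
    "eva (P * Q) = eva P * eva Q"
    "eva (Polynomial.smult c P) = of_int c * eva P"
    "eva (Polynomial.monom c i) = of_int c * \<alpha> ^ i" "eva 1 = 1" "eva 0 = 0"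
    for P Q c i
    by (simp_all add: eva_def of_int_poly_add of_int_poly_diff of_int_poly_mult of_int_poly_smult
        map_poly_monom poly_monom)
  have evb_simps: "evb x (P + Q) = evb x P + evb x Q" "evb x (P - Q) = evb x P - evb x Q"
    "evb x (P * Q) = evb x P * evb x Q"
    "evb x (Polynomial.smult c P) = of_int c * evb x P"
    "evb x (Polynomial.monom c i) = of_int c * x ^ i" "evb x 1 = 1" "evb x 0 = 0"
    for P Q c i x
    by (simp_all add: evb_def of_int_poly_add of_int_poly_diff of_int_poly_mult of_int_poly_smult
        map_poly_monom poly_monom)
  have of_int_transfer: "(of_int c :: 'a) = 0 \<longleftrightarrow> (of_int c :: 'b) = 0" for c
    by (simp add: of_int_eq_0_iff_char_dvd char)
  define Z :: "int poly \<Rightarrow> bool" where "Z P \<longleftrightarrow> (of_int_poly P :: 'a poly) = 0" for P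
  have Z_b: "Z P \<longleftrightarrow> (of_int_poly P :: 'b poly) = 0" for P
    unfolding Z_def by (rule of_int_poly_eq_0_transfer[OF char])
  \<comment> \<open>With \<open>Q = CARD('b)\<close>, this is \<open>X^Q - X\<close>. It kills
    \<alpha> because \<open>Q\<close> is a power of \<open>CARD('a)\<close>, and it kills all of
    \<open>'b\<close>.\<close>
  define E :: "int poly" where "E = Polynomial.monom 1 CARD('b) - Polynomial.monom 1 1"
  have card_gt: "CARD('b) > 1" by (rule card_field_gt_1)
  have E_a: "eva E = 0"
    using finite_field_power_card[of \<alpha> m] by (simp add: E_def eva_simps card)
  have E_b: "evb x E = 0" for x
    using finite_field_power_card[of x 1] by (simp add: E_def evb_simps)
  have E_lead: "Polynomial.coeff (of_int_poly E :: 'b poly) CARD('b) = 1"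
    using card_gt by (simp add: coeff_map_poly E_def)
  have deg_E: "Polynomial.degree (of_int_poly E :: 'b poly) \<le> CARD('b)"
    using card_gt by (intro degree_le) (auto simp: coeff_map_poly E_def)
  have "\<exists>P. eva P = 0 \<and> \<not> Z P"
    using E_a E_lead Z_b by (intro exI[of _ E]) auto
  \<comment> \<open>\<open>P\<close> plays the role of a minimal polynomial of \<open>\<alpha>\<close> over the prime field, lifted to the integers
    so that it can be evaluated in both fields.\<close>
  then obtain P where P: "eva P = 0" "\<not> Z P"
    and P_min: "\<And>R. eva R = 0 \<Longrightarrow> \<not> Z R \<Longrightarrow> Polynomial.degree P \<le> Polynomial.degree R"
    using ex_has_least_nat[of "\<lambda>P. eva P = 0 \<and> \<not> Z P" _ Polynomial.degree] by blast
  define d c where "d = Polynomial.degree P" and "c = Polynomial.coeff P d"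
  \<comment> \<open>Otherwise dropping the leading term of \<open>P\<close> would change nothing in
    \<open>'a\<close> and would lower the degree, against minimality.\<close>
  have c_a: "(of_int c :: 'a) \<noteq> 0"
  proof
    assume c0: "(of_int c :: 'a) = 0"
    define R where "R = P - Polynomial.monom c d"
    have ZR: "\<not> Z R"
      using P(2) c0 by (simp add: R_def Z_def of_int_poly_diff map_poly_monom)
    have "Polynomial.coeff R i = 0" if "i \<ge> d" for i
      using that by (cases "i = d") (auto simp: R_def c_def d_def coeff_eq_0)
    moreover have "R \<noteq> 0" using ZR by (auto simp: Z_def)
    ultimately have "Polynomial.degree R < d"
      by (metis leading_coeff_0_iff not_le_imp_less)
    moreover have "eva R = 0" by (simp add: R_def eva_simps P c0)
    ultimately show False using P_min[of R] ZR by (simp add: d_def)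
  qed
  then have c_b: "(of_int c :: 'b) \<noteq> 0" by (simp add: of_int_transfer)
  \<comment> \<open>Over the integers only pseudo-division is available, hence the factor
    \<open>c ^ k\<close>, a unit in both fields. The remainder kills \<alpha> and is zero or of
    degree below \<open>d\<close>, so by minimality it vanishes modulo the characteristic.\<close>
  have division: "\<exists>k G. of_int_poly (Polynomial.smult (c ^ k) F) = (of_int_poly (P * G) :: 'b poly)"
    if "eva F = 0" for F
  proof -
    obtain G R where GR: "pseudo_divmod F P = (G, R)" by force
    define k where "k = Suc (Polynomial.degree F) - Polynomial.degree P"
    have P0: "P \<noteq> 0" using P(2) by (auto simp: Z_def)
    have eq: "Polynomial.smult (c ^ k) F = P * G + R" and R: "R = 0 \<or> Polynomial.degree R < d"
      using pseudo_divmod[OF P0 GR] by (auto simp: c_def d_def k_def)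
    have "eva R = 0"
      using arg_cong[OF eq, of eva] that P by (simp add: eva_simps)
    then have "Z R" using R P_min[of R] by (force simp: d_def Z_def)
    then show ?thesis
      using eq by (intro exI[of _ k] exI[of _ G]) (simp add: of_int_poly_add Z_b)
  qed
  \<comment> \<open>\<open>X^CARD('b) - X\<close> splits over \<open>'b\<close> and, up to a unit, \<open>P\<close> divides it, so \<open>P\<close> has a root there.\<close>
  obtain \<beta> where \<beta>: "evb \<beta> P = 0"
  proof (rule ccontr)
    assume "\<not> thesis"
    then have noroot: "evb x P \<noteq> 0" for x using that by blast
    obtain k G where kG: "of_int_poly (Polynomial.smult (c ^ k) E) = (of_int_poly (P * G) :: 'b poly)"
      using division[OF E_a] by blast
    let ?Pb = "of_int_poly P :: 'b poly" and ?Gb = "of_int_poly G :: 'b poly"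
      and ?Eb = "of_int_poly E :: 'b poly"
    have eq: "Polynomial.smult (of_int c ^ k) ?Eb = ?Pb * ?Gb"
      using kG by (simp add: of_int_poly_mult of_int_poly_smult)
    \<comment> \<open>If \<open>P\<close> has no root, the cofactor must vanish on all of
      \<open>'b\<close>. It then has degree at least \<open>CARD('b)\<close>, which leaves degree 0
      for \<open>P\<close>.\<close>
    have "poly ?Gb x = 0" for x
      using arg_cong[OF eq, of "\<lambda>p. poly p x"] E_b[of x] noroot[of x] by (auto simp: evb_def)
    then have roots: "{x. poly ?Gb x = 0} = UNIV" by simp
    have "?Eb \<noteq> 0" using E_lead by auto
    then have nz: "?Pb * ?Gb \<noteq> 0" using c_b by (simp flip: eq)
    then have deg: "Polynomial.degree ?Pb + Polynomial.degree ?Gb \<le> CARD('b)"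
      using deg_E c_b eq by (metis degree_mult_eq degree_smult_eq mult_zero_left mult_zero_right power_not_zero)
    have "CARD('b) \<le> Polynomial.degree ?Gb"
      using card_poly_roots_bound[of ?Gb] nz roots by auto
    with deg have "Polynomial.degree ?Pb = 0" by simp
    moreover have "Polynomial.coeff ?Pb d \<noteq> 0" using c_b by (simp add: coeff_map_poly c_def)
    ultimately have "d = 0" using le_degree by fastforce
    then have "P = [:c:]" by (metis c_def d_def degree_0_id)
    then have "eva P = of_int c" by (simp add: eva_def map_poly_pCons)
    with P c_a show False by simp
  qed
  \<comment> \<open>This makes \<open>F(\<alpha>) \<mapsto> F(\<beta>)\<close> independent of the
    choice of \<open>F\<close>, so the \<open>SOME\<close> in the definition of \<iota> is
    harmless.\<close>
  have kernel: "evb \<beta> F = 0" if F: "eva F = 0" for F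
  proof -
    obtain k G where "of_int_poly (Polynomial.smult (c ^ k) F) = (of_int_poly (P * G) :: 'b poly)"
      using division[OF F] by blast
    then have "evb \<beta> (Polynomial.smult (c ^ k) F) = evb \<beta> (P * G)" by (simp add: evb_def)
    then show ?thesis using \<beta> c_b by (simp add: evb_simps)
  qed
  have surj: "\<exists>F. eva F = x" for x
  proof (cases "x = 0")
    case False
    then obtain i where "x = \<alpha> ^ i" using gen by blast
    then have "eva (Polynomial.monom 1 i) = x" by (simp add: eva_simps)
    then show ?thesis ..
  qed (use eva_simps in blast)
  define \<iota> where "\<iota> x = evb \<beta> (SOME F. eva F = x)" for x
  have \<iota>: "\<iota> (eva F) = evb \<beta> F" for F
  proof -
    have "eva (SOME F'. eva F' = eva F) = eva F" by (rule someI) simp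
    then have "eva ((SOME F'. eva F' = eva F) - F) = 0" by (simp add: eva_simps)
    from kernel[OF this] show ?thesis by (simp add: \<iota>_def evb_simps)
  qed
  show thesis
  proof (rule that[of \<iota>])
    show "\<iota> 1 = 1" using \<iota>[of 1] by (simp add: eva_simps evb_simps)
    show "\<iota> (x + y) = \<iota> x + \<iota> y" for x y
      using surj[of x] surj[of y] by (metis \<iota> eva_simps(1) evb_simps(1))
    show "\<iota> (x * y) = \<iota> x * \<iota> y" for x y
      using surj[of x] surj[of y] by (metis \<iota> eva_simps(3) evb_simps(3))
  qed
qed

section \<open>Counting elements, and coordinates over a subfield\<close>

lemma (in vector_space) card_subspace:
  assumes S: "subspace S" "finite S"
  shows "card S = CARD('a) ^ dim S"
proof -
  obtain B where B: "B \<subseteq> S" "independent B" "S \<subseteq> span B" "card B = dim S"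
    using basis_exists by blast
  have finB: "finite B" using B(1) S(2) finite_subset by blast
  have span: "span B = S"
    using B S(1) span_minimal by blast
  \<comment> \<open>Restricting coefficient functions to \<open>B\<close> makes them unique:
    spanning gives surjectivity of \<open>f\<close> onto \<open>S\<close>, independence gives
    injectivity.\<close>
  define f where "f u = (\<Sum>v\<in>B. u v *s v)" for u
  have "S \<subseteq> f ` (B \<rightarrow>\<^sub>E UNIV)"
  proof
    fix x assume "x \<in> S"
    then obtain u where "x = f u"
      using span_finite[OF finB] span by (auto simp: f_def)
    then have "x = f (restrict u B)" by (simp add: f_def)
    moreover have "f (restrict u B) \<in> f ` (B \<rightarrow>\<^sub>E UNIV)" by (rule imageI) (auto simp: PiE_def extensional_def)
    ultimately show "x \<in> f ` (B \<rightarrow>\<^sub>E UNIV)" by simp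
  qed
  moreover have "f ` (B \<rightarrow>\<^sub>E UNIV) \<subseteq> S"
    using span_finite[OF finB] span by (auto simp: f_def)
  moreover have "inj_on f (B \<rightarrow>\<^sub>E UNIV)"
  proof (rule inj_onI)
    fix u w assume uw: "u \<in> B \<rightarrow>\<^sub>E UNIV" "w \<in> B \<rightarrow>\<^sub>E UNIV" "f u = f w"
    then have "(\<Sum>v\<in>B. (u v - w v) *s v) = 0"
      by (simp add: f_def scale_left_diff_distrib sum_subtractf)
    then have "u v = w v" if "v \<in> B" for v
      using independentD[OF B(2) finB subset_refl _ that, of "\<lambda>v. u v - w v"] by simp
    then show "u = w" using uw by (intro PiE_ext) auto
  qed
  ultimately have "card S = card (B \<rightarrow>\<^sub>E (UNIV :: 'a set))"
    by (metis card_image subset_antisym)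
  then show ?thesis using finB B(4) by (simp add: card_PiE)
qed

lemma subspace_vectors: "fun_vs.subspace (vectors d)"
  by (auto simp: fun_vs.subspace_def vectors_def fun_scale_def)

lemma bij_betw_vectors_PiE:
  "bij_betw (\<lambda>v. restrict v {..<d}) (vectors d) ({..<d} \<rightarrow>\<^sub>E (UNIV :: 'a::field set))"
proof (rule bij_betwI[where g = "\<lambda>u i. if i < d then u i else 0"])
qed (auto simp: vectors_def fun_eq_iff PiE_def extensional_def restrict_def)

lemma card_vectors: "card (vectors d :: (nat \<Rightarrow> 'a::field) set) = CARD('a) ^ d"
  by (simp add: bij_betw_same_card[OF bij_betw_vectors_PiE] card_PiE)

lemma finite_vectors: "finite (vectors d :: (nat \<Rightarrow> 'a::{field, finite}) set)"
  by (rule card_ge_0_finite) (simp add: card_vectors)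

text \<open>Scalars act on \<open>'b\<close> through \<iota>. Counting shows that a basis has
  \<open>m\<close> elements; \<open>c\<close> is the inverse of the map \<open>f\<close> that forms
  linear combinations of this basis.\<close>

lemma coordinates_over_subfield:
  fixes \<iota> :: "'a::{field, finite} \<Rightarrow> 'b::{field, finite}"
  assumes \<iota>: "\<iota> 1 = 1" "\<And>x y. \<iota> (x + y) = \<iota> x + \<iota> y" "\<And>x y. \<iota> (x * y) = \<iota> x * \<iota> y"
    and card: "CARD('b) = CARD('a) ^ m"
  obtains c :: "'b \<Rightarrow> nat \<Rightarrow> 'a" where "bij_betw c UNIV (vectors m)"
    "\<And>x y. c (x + y) = c x + c y" "\<And>a x. c (\<iota> a * x) = fun_scale a (c x)"
proof -
  interpret V: vector_space "\<lambda>a x. \<iota> a * x"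
    by unfold_locales (simp_all add: \<iota> distrib_left distrib_right mult.assoc)
  obtain B where B: "V.independent B" "UNIV \<subseteq> V.span B" "card B = V.dim UNIV"
    by (rule V.basis_exists)
  have "CARD('b) = CARD('a) ^ V.dim UNIV"
    by (rule V.card_subspace[OF V.subspace_UNIV finite])
  with card B(3) card_field_gt_1[where ?'a = 'a] have cB: "card B = m" by simp
  obtain e where e: "bij_betw e {..<m} B"
    using ex_bij_betw_nat_finite[OF finite, of B] unfolding cB atLeast0LessThan by blast
  define f where "f v = (\<Sum>i<m. \<iota> (v i) * e i)" for v
  have "x \<in> f ` vectors m" for x
  proof -
    obtain u where "x = (\<Sum>v\<in>B. \<iota> (u v) * v)"
      using B(2) V.span_finite[OF finite, of B] by blast
    also have "\<dots> = f (\<lambda>i. if i < m then u (e i) else 0)"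
      by (simp add: f_def sum.reindex_bij_betw[OF e, symmetric])
    finally show ?thesis by (auto simp: vectors_def)
  qed
  then have surj: "f ` vectors m = UNIV" by blast
  \<comment> \<open>A surjection between finite sets of equal size is injective.\<close>
  then have "inj_on f (vectors m)"
    by (intro eq_card_imp_inj_on finite_vectors) (simp add: card_vectors card)
  with surj have bij: "bij_betw f (vectors m) UNIV" by (simp add: bij_betw_def)
  define c where "c = inv_into (vectors m) f"
  have cv: "c x \<in> vectors m" and fc: "f (c x) = x" for x
    using surj by (auto simp: c_def inv_into_into f_inv_into_f)
  \<comment> \<open>Reduces the linearity of the inverse \<open>c\<close> to that of
    \<open>f\<close>.\<close>
  have cI: "c x = v" if "f v = x" "v \<in> vectors m" for x v
    using that bij by (metis bij_betw_inv_into_left c_def)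
  show thesis
  proof (rule that[of c])
    show "bij_betw c UNIV (vectors m)"
      unfolding c_def by (rule bij_betw_inv_into[OF bij])
    show "c (x + y) = c x + c y" for x y
    proof (rule cI)
      have "f (c x + c y) = f (c x) + f (c y)"
        by (simp add: f_def \<iota> algebra_simps sum.distrib)
      then show "f (c x + c y) = x + y" by (simp add: fc)
    qed (intro fun_vs.subspace_add subspace_vectors cv)
    show "c (\<iota> a * x) = fun_scale a (c x)" for a x
    proof (rule cI)
      have "f (fun_scale a (c x)) = (\<Sum>i<m. \<iota> a * (\<iota> (c x i) * e i))"
        by (simp add: f_def fun_scale_def flip: \<iota>(3))
      also have "\<dots> = \<iota> a * f (c x)"
        by (simp only: f_def sum_distrib_left)
      finally have "f (fun_scale a (c x)) = \<iota> a * f (c x)" .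
      then show "f (fun_scale a (c x)) = \<iota> a * x" by (simp add: fc)
    qed (intro fun_vs.subspace_scale subspace_vectors cv)
  qed
qed

section \<open>Turning the cyclic shift into the block shift\<close>

definition concat_blocks :: "nat \<Rightarrow> nat \<Rightarrow> ('b \<Rightarrow> nat \<Rightarrow> 'a) \<Rightarrow> (nat \<Rightarrow> 'b) \<Rightarrow> nat \<Rightarrow> 'a::field" where
  "concat_blocks m n c w = (\<lambda>i. if i < m * n then c (w (i div m)) (i mod m) else 0)"

text \<open>Position \<open>i\<close> has offset \<open>i mod m\<close> in block
  \<open>i div m\<close>. Going back \<open>m\<close> positions keeps the offset and lowers the
  block number by one; positions below \<open>m\<close> read block \<open>n - 1\<close>
  instead.\<close>

lemma concat_blocks_cyclic_shift:
  assumes "m > 0"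
  shows "concat_blocks m n c (cyclic_shift n w) = block_shift m n (concat_blocks m n c w)"
proof
  fix i
  show "concat_blocks m n c (cyclic_shift n w) i = block_shift m n (concat_blocks m n c w) i"
  proof (cases "i < m * n")
    case i: True
    then have n: "n > 0" by (cases n) auto
    have div: "i div m < n" using i by (simp add: less_mult_imp_div_less mult.commute)
    show ?thesis
    proof (cases "i < m")
      case True
      have "m * (n - 1) + i < m * n"
        using True n by (cases n) (auto simp: algebra_simps)
      then show ?thesis
        using True i n by (simp add: concat_blocks_def cyclic_shift_def block_shift_def)
    next
      case False
      then have "(i - m) div m = i div m - 1" "(i - m) mod m = i mod m" "i div m > 0"
        using assms by (simp_all add: div_if mod_if le_mod_geq div_greater_zero_iff)
      then show ?thesis
        using False i div by (simp add: concat_blocks_def cyclic_shift_def block_shift_def)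
    qed
  qed (simp add: concat_blocks_def block_shift_def)
qed

lemma bij_betw_concat_blocks:
  assumes m: "m > 0" and c: "bij_betw c UNIV (vectors m)"
  shows "bij_betw (concat_blocks m n c) (vectors n) (vectors (m * n))"
  unfolding bij_betw_def
proof
  have pos: "m * j + i < m * n" if "i < m" "j < n" for i j
  proof -
    have "m * j + i < m * Suc j" using that by simp
    also have "\<dots> \<le> m * n" using that by (intro mult_left_mono) auto
    finally show ?thesis .
  qed
  show "inj_on (concat_blocks m n c) (vectors n)"
  proof (rule inj_onI, rule ext)
    fix v w j
    assume vw: "v \<in> vectors n" "w \<in> vectors n" and eq: "concat_blocks m n c v = concat_blocks m n c w"
    show "v j = w j"
    proof (cases "j < n")
      case j: True
      have "c (v j) i = c (w j) i" for i
      proof (cases "i < m")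
        case True
        then show ?thesis
          using fun_cong[OF eq, of "m * j + i"] pos[OF True j] by (simp add: concat_blocks_def)
      next
        case False
        \<comment> \<open>Offsets from \<open>m\<close> on are not seen in the concatenation, but
          there all values of \<open>c\<close> vanish.\<close>
        then show ?thesis
          using bij_betwE[OF c] by (simp add: vectors_def)
      qed
      then have "c (v j) = c (w j)" ..
      then show ?thesis using c by (auto simp: bij_betw_def dest: injD)
    qed (use vw in \<open>simp add: vectors_def\<close>)
  qed
  show "concat_blocks m n c ` vectors n = vectors (m * n)"
  proof
    show "concat_blocks m n c ` vectors n \<subseteq> vectors (m * n)"
      by (auto simp: concat_blocks_def vectors_def)
    show "vectors (m * n) \<subseteq> concat_blocks m n c ` vectors n"
    proof
      fix v :: "nat \<Rightarrow> 'b" assume v: "v \<in> vectors (m * n)"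
      \<comment> \<open>The preimage of \<open>v\<close>: cut \<open>v\<close> into blocks and apply
        the inverse of \<open>c\<close> to each. The default 0 of \<open>w\<close> puts it into
        \<open>vectors n\<close>.\<close>
      define b where "b j = (\<lambda>i. if i < m then v (m * j + i) else 0)" for j
      define w where "w j = (if j < n then inv_into UNIV c (b j) else 0)" for j
      have "b j \<in> range c" for j
        using c by (auto simp: bij_betw_def b_def vectors_def)
      then have cw: "c (w j) = b j" if "j < n" for j
        using that by (simp add: w_def f_inv_into_f)
      have "concat_blocks m n c w i = v i" for i
      proof (cases "i < m * n")
        case True
        then have "i div m < n" by (simp add: less_mult_imp_div_less mult.commute)
        then show ?thesis using True m by (simp add: concat_blocks_def cw b_def)
      qed (use v in \<open>simp add: concat_blocks_def vectors_def\<close>)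
      then have "v = concat_blocks m n c w" by (simp add: fun_eq_iff)
      then show "v \<in> concat_blocks m n c ` vectors n"
        by (auto simp: w_def vectors_def)
    qed
  qed
qed

text \<open>Intertwining \<open>T\<close> and \<open>T'\<close> carries over to their powers, and
  images commute with unions. The two spaces may be over different fields, so \<open>sub\<close> is
  assumed in place of linearity of \<open>F\<close>.\<close>

lemma covering_image:
  assumes U: "covering T n d U" and F: "F ` vectors d = vectors d'"
    and FT: "\<And>v. F (T v) = T' (F v)" and sub: "fun_vs.subspace (F ` U)"
  shows "covering T' n d' (F ` U)"
proof -
  have pow: "F ((T ^^ i) v) = (T' ^^ i) (F v)" for i v
    by (induction i) (simp_all add: FT)
  have "(\<Union>i<n. (T' ^^ i) ` F ` U) = F ` (\<Union>i<n. (T ^^ i) ` U)"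
    by (simp add: image_UN image_image pow)
  then show ?thesis using U F sub image_mono[of U "vectors d" F] by (simp add: covering_def)
qed

text \<open>Makes the set of codimensions nonempty, so that its maximum is attained. The zeroth
  power of the shift already covers, and it occurs because \<open>n > 0\<close>.\<close>

lemma cyclically_covering_vectors:
  assumes "n > 0" shows "cyclically_covering n (vectors n)"
proof -
  have "(cyclic_shift n ^^ i) v \<in> vectors n" if "v \<in> vectors n" for i and v :: "nat \<Rightarrow> 'a"
    using that by (cases i) (simp_all add: vectors_def cyclic_shift_def)
  moreover have "vectors n \<subseteq> (cyclic_shift n ^^ 0) ` vectors n" by simp
  ultimately show ?thesis
    using assms by (auto simp: covering_def subspace_vectors image_subset_iff)
qed

lemma block_covering_of_cyclically_covering:
  fixes \<iota> :: "'a::{field, finite} \<Rightarrow> 'b::{field, finite}"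
  assumes m: "m > 0"
    and \<iota>: "\<iota> 1 = 1" "\<And>x y. \<iota> (x + y) = \<iota> x + \<iota> y" "\<And>x y. \<iota> (x * y) = \<iota> x * \<iota> y"
    and card: "CARD('b) = CARD('a) ^ m"
    and U: "cyclically_covering n (U :: (nat \<Rightarrow> 'b) set)"
  obtains V :: "(nat \<Rightarrow> 'a) set" where "block_covering m n V" "fun_vs.dim V = m * fun_vs.dim U"
proof -
  obtain c :: "'b \<Rightarrow> nat \<Rightarrow> 'a" where c: "bij_betw c UNIV (vectors m)"
    and c_add: "\<And>x y. c (x + y) = c x + c y"
    and c_scale: "\<And>a x. c (\<iota> a * x) = fun_scale a (c x)"
    using coordinates_over_subfield[OF \<iota> card] by metis
  let ?F = "concat_blocks m n c"
  have subU: "fun_vs.subspace U" "U \<subseteq> vectors n" using U by (auto simp: covering_def)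
  have bij: "bij_betw ?F (vectors n) (vectors (m * n))"
    by (rule bij_betw_concat_blocks[OF m c])
  have F_add: "?F (v + w) = ?F v + ?F w" for v w
    by (simp add: concat_blocks_def fun_eq_iff c_add)
  \<comment> \<open>Multiplication by \<iota> \<open>a\<close> becomes multiplication by
    \<open>a\<close>, so the image of a subspace over \<open>'b\<close> is a subspace over
    \<open>'a\<close>.\<close>
  have F_scale: "?F (fun_scale (\<iota> a) v) = fun_scale a (?F v)" for a v
    by (simp add: concat_blocks_def fun_eq_iff fun_scale_def c_scale)
  have F_0: "?F 0 = 0"
    using F_add[of 0 0] by simp
  have sub: "fun_vs.subspace (?F ` U)"
    unfolding fun_vs.subspace_def
  proof (intro conjI ballI allI)
    show "0 \<in> ?F ` U"
      using F_0 fun_vs.subspace_0[OF subU(1)] by (metis imageI)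
    show "x + y \<in> ?F ` U" if "x \<in> ?F ` U" "y \<in> ?F ` U" for x y
      using that fun_vs.subspace_add[OF subU(1)] by (auto simp flip: F_add)
    show "fun_scale a x \<in> ?F ` U" if "x \<in> ?F ` U" for a x
      using that fun_vs.subspace_scale[OF subU(1)] by (auto simp flip: F_scale)
  qed
  have finU: "finite U" using subU(2) finite_vectors finite_subset by blast
  have "inj_on ?F U" using bij subU(2) by (auto simp: bij_betw_def intro: inj_on_subset)
  then have "card (?F ` U) = card U" by (rule card_image)
  \<comment> \<open>Both sides count \<open>U\<close>: over \<open>'a\<close> through its image,
    over \<open>'b\<close> directly with \<open>CARD('b) = CARD('a) ^ m\<close>.\<close>
  then have "CARD('a) ^ fun_vs.dim (?F ` U) = CARD('a) ^ (m * fun_vs.dim U)"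
    using fun_vs.card_subspace[OF sub] fun_vs.card_subspace[OF subU(1) finU] finU
    by (simp add: card power_mult)
  then have "fun_vs.dim (?F ` U) = m * fun_vs.dim U"
    using card_field_gt_1[where ?'a = 'a] by simp
  moreover have "block_covering m n (?F ` U)"
    using covering_image[OF U _ concat_blocks_cyclic_shift[OF m] sub] bij
    by (simp add: bij_betw_def)
  ultimately show thesis by (rule that[rotated])
qed

section \<open>Comparing the largest codimensions\<close>

lemma CHAR_eq_of_primepow:
  assumes "primepow CARD('a::{field, finite})" "CARD('b::{field, finite}) = CARD('a) ^ m"
  shows "CHAR('a) = CHAR('b)"
proof -
  obtain p k where p: "prime p" "CARD('a) = p ^ k"
    using assms(1) by (auto simp: primepow_def)
  have "prime CHAR('a)" "prime CHAR('b)"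
    by (simp_all add: prime_CHAR_semidom finite_imp_CHAR_pos)
  \<comment> \<open>The characteristic divides the cardinality, so both characteristics are primes
    dividing a power of \<open>p\<close>.\<close>
  moreover have "CHAR('a) dvd p ^ k" "CHAR('b) dvd p ^ (k * m)"
    using CHAR_dvd_CARD[where ?'a = 'a] CHAR_dvd_CARD[where ?'a = 'b] p assms(2)
    by (simp_all add: power_mult)
  ultimately show ?thesis
    using p(1) by (metis prime_dvd_power primes_dvd_imp_eq)
qed

theorem theorem4p1:
  fixes q m n :: nat
  assumes "primepow q" and "m > 0" and "n > 0"
    and "CARD('a::{field, finite}) = q"
    and "CARD('b::{field, finite}) = q ^ m"
  shows "(\<forall>k. h_cyclic TYPE('b) n = k \<longrightarrow> h_block TYPE('a) m n \<ge> m * k) \<and>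
         (h_block TYPE('a) m n \<le> m - 1 \<longrightarrow> h_cyclic TYPE('b) n = 0)"
proof -
  have card: "CARD('b) = CARD('a) ^ m" and pp: "primepow CARD('a)"
    using assms by simp_all
  obtain \<iota> :: "'a \<Rightarrow> 'b" where
    \<iota>: "\<iota> 1 = 1" "\<And>x y. \<iota> (x + y) = \<iota> x + \<iota> y" "\<And>x y. \<iota> (x * y) = \<iota> x * \<iota> y"
    using finite_field_embedding[OF CHAR_eq_of_primepow[OF pp card] card] by metis
  let ?C = "{n - fun_vs.dim U |U :: (nat \<Rightarrow> 'b) set. cyclically_covering n U}"
  let ?D = "{m * n - fun_vs.dim U |U :: (nat \<Rightarrow> 'a) set. block_covering m n U}"
  have "finite ?C" by (rule finite_subset[of _ "{..n}"]) auto
  moreover have "?C \<noteq> {}" using cyclically_covering_vectors[OF \<open>n > 0\<close>] by blast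
  ultimately have "Max ?C \<in> ?C" by (rule Max_in)
  then obtain U :: "(nat \<Rightarrow> 'b) set" where U: "cyclically_covering n U"
    and hU: "h_cyclic TYPE('b) n = n - fun_vs.dim U"
    by (auto simp: h_cyclic_def)
  obtain V :: "(nat \<Rightarrow> 'a) set" where V: "block_covering m n V" "fun_vs.dim V = m * fun_vs.dim U"
    using block_covering_of_cyclically_covering[OF \<open>m > 0\<close> \<iota> card U] by metis
  have "finite ?D" by (rule finite_subset[of _ "{..m * n}"]) auto
  then have "m * n - fun_vs.dim V \<le> h_block TYPE('a) m n"
    unfolding h_block_def using V(1) by (intro Max_ge) auto
  \<comment> \<open>The image of an optimal \<open>U\<close> has codimension
    \<open>m * n - m * dim U\<close>, which is \<open>m\<close> times that of
    \<open>U\<close>.\<close>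
  then have le: "m * h_cyclic TYPE('b) n \<le> h_block TYPE('a) m n"
    by (simp add: hU V(2) diff_mult_distrib2)
  moreover have "h_cyclic TYPE('b) n = 0" if "h_block TYPE('a) m n \<le> m - 1"
  proof (rule ccontr)
    assume "h_cyclic TYPE('b) n \<noteq> 0"
    \<comment> \<open>A positive value would force \<open>m \<le> m - 1\<close>, impossible for
      \<open>m > 0\<close>.\<close>
    then have "m \<le> m * h_cyclic TYPE('b) n" by simp
    with le that \<open>m > 0\<close> show False by linarith
  qed
  ultimately show ?thesis by simp
qed

end
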